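(* Let $T\in A\otimes B\otimes C=\mathbb C^m\otimes\mathbb C^m\otimes\mathbb C^m$ be concise. If $T$ satisfies the 111-equations, then $T$ also satisfies Strassen's equations (that is, the $A$-, $B$- and $C$-Strassen equations) and the End-closed equations (that is, the $A$-, $B$- and $C$-End-closed equations). If (in addition to being concise) $T$ is $1_A$-generic, then $T$ satisfies the 111-equations if and only if it satisfies the $A$-Strassen equations and the $A$-End-closed equations.
   Context: $A,B,C$ are complex vector spaces of dimension $m$. A tensor $T\in A\otimes B\otimes C$ is viewed as linear maps $T_A:A^*\to B\otimes C$, $T_B:B^*\to A\otimes C$, $T_C:C^*\to A\otimes B$ with images $T(A^* ),T(B^* ),T(C^* )$; write $T(\alpha)=T_A(\alpha)\in B\otimes C=\mathrm{Hom}(B^*,C)$ for $\alpha\in A^*$. $T$ is concise if $T_A,T_B,T_C$ are all injective. $T$ is $1_A$-generic if $T(A^* )$ contains an element of rank $m$. 111-equations: regard $T(A^* )\otimes A$, $T(B^* )\otimes B$, $T(C^* )\otimes C$ as subspaces of $A\otimes B\otimes C$ (with factors put in the correct positions). The 111-equations say that the linear map $$(T(A^* )\otimes A)\oplus (T(B^* )\otimes B)\oplus (T(C^* )\otimes C)\to (A\otimes B\otimes C)\oplus (A\otimes B\otimes C),\quad (T_1,T_2,T_3)\mapsto (T_1-T_2,\,T_2-T_3)$$ has rank at most $3m^2-m$. $A$-Strassen equations: after choosing bases of $B$ and $C$ so that each $T(\alpha)$ is an $m\times m$ matrix, for all $\alpha,\alpha',\alpha''\in A^*$, $$T(\alpha')\,T(\alpha)^{\wedge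 m-1}\,T(\alpha'')=T(\alpha'')\,T(\alpha)^{\wedge m-1}\,T(\alpha'),$$ where $T(\alpha)^{\wedge m-1}:C\to B^*$ is the adjugate (transposed cofactor) matrix of $T(\alpha)$. $A$-End-closed equations: for every basis $\alpha_1,\dots,\alpha_m$ of $A^*$ and all $\alpha',\alpha''\in A^*$, $$\big(T(\alpha')\,T(\alpha_1)^{\wedge m-1}\,T(\alpha'')\big)\wedge T(\alpha_1)\wedge\cdots\wedge T(\alpha_m)=0\in\Lambda^{m+1}(B\otimes C).$$ The $B$- and $C$-Strassen and End-closed equations are defined in the same way with the roles of $A,B,C$ permuted. *)

theory Defs
  imports "HOL-Analysis.Analysis"
begin

text \<open>
  We take $A = B = C = \mathbb{C}^m$ with $m$ the cardinality of the index type \<open>'m\<close>.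
  The space $A \otimes B \otimes C$ is the coordinate space on index triples \<open>(i, j, k)\<close>,
  with \<open>i\<close>, \<open>j\<close>, \<open>k\<close> belonging to \<open>A\<close>, \<open>B\<close>, \<open>C\<close> respectively; in this form it carries
  the library's complex vector space structure \<open>(*s)\<close> with its \<open>vec.span\<close> and \<open>vec.dim\<close>.
  Elements of the dual spaces are given by their coordinates in the dual basis.
\<close>

type_synonym 'm tensor = "complex ^ ('m \<times> 'm \<times> 'm)"

text \<open>
  The maps $T_A$, $T_B$, $T_C$. An element of $B \otimes C = \mathrm{Hom}(B^*, C)$ is
  written as its matrix: rows are indexed by \<open>C\<close> and columns by \<open>B\<close>, so that \<open>(**)\<close> is the
  composition of maps. Similarly $A \otimes C = \mathrm{Hom}(A^*, C)$ and
  $A \otimes B = \mathrm{Hom}(A^*, B)$.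
\<close>

definition T\<^sub>A :: "'m::finite tensor \<Rightarrow> complex ^ 'm \<Rightarrow> complex ^ 'm ^ 'm" where
  "T\<^sub>A T \<alpha> = (\<chi> k j. \<Sum>i\<in>UNIV. \<alpha> $ i * T $ (i, j, k))"

definition T\<^sub>B :: "'m::finite tensor \<Rightarrow> complex ^ 'm \<Rightarrow> complex ^ 'm ^ 'm" where
  "T\<^sub>B T \<beta> = (\<chi> k i. \<Sum>j\<in>UNIV. \<beta> $ j * T $ (i, j, k))"

definition T\<^sub>C :: "'m::finite tensor \<Rightarrow> complex ^ 'm \<Rightarrow> complex ^ 'm ^ 'm" where
  "T\<^sub>C T \<gamma> = (\<chi> j i. \<Sum>k\<in>UNIV. \<gamma> $ k * T $ (i, j, k))"

definition concise :: "'m::finite tensor \<Rightarrow> bool" where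
  "concise T \<longleftrightarrow> inj (T\<^sub>A T) \<and> inj (T\<^sub>B T) \<and> inj (T\<^sub>C T)"

definition one_A_generic :: "'m::finite tensor \<Rightarrow> bool" where
  "one_A_generic T \<longleftrightarrow> (\<exists>M\<in>range (T\<^sub>A T). rank M = CARD('m))"


subsection \<open>The 111-equations\<close>

text \<open>$T(A^*) \otimes A$, $T(B^*) \otimes B$, $T(C^*) \otimes C$ inside $A \otimes B \otimes C$\<close>

definition TA_tensor_A :: "'m::finite tensor \<Rightarrow> 'm tensor set" where
  "TA_tensor_A T = vec.span {\<chi> p. case p of (i, j, k) \<Rightarrow> M $ k $ j * a $ i | M a. M \<in> range (T\<^sub>A T)}"

definition TB_tensor_B :: "'m::finite tensor \<Rightarrow> 'm tensor set" where
  "TB_tensor_B T = vec.span {\<chi> p. case p of (i, j, k) \<Rightarrow> M $ k $ i * b $ j | M b. M \<in> range (T\<^sub>B T)}"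

definition TC_tensor_C :: "'m::finite tensor \<Rightarrow> 'm tensor set" where
  "TC_tensor_C T = vec.span {\<chi> p. case p of (i, j, k) \<Rightarrow> M $ j $ i * c $ k | M c. M \<in> range (T\<^sub>C T)}"

interpretation vec_prod: finite_dimensional_vector_space_prod
  "(*s) :: 'a::field \<Rightarrow> 'a ^ 'n \<Rightarrow> 'a ^ 'n"
  "(*s) :: 'a::field \<Rightarrow> 'a ^ 'k \<Rightarrow> 'a ^ 'k"
  cart_basis cart_basis
  ..

definition map111 :: "'m::finite tensor \<times> 'm tensor \<times> 'm tensor \<Rightarrow> 'm tensor \<times> 'm tensor" where
  "map111 = (\<lambda>(T1, T2, T3). (T1 - T2, T2 - T3))"

definition equations111 :: "'m::finite tensor \<Rightarrow> bool" where
  "equations111 T \<longleftrightarrow>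
     vec_prod.p.dim (map111 ` (TA_tensor_A T \<times> TB_tensor_B T \<times> TC_tensor_C T))
       \<le> 3 * CARD('m)\<^sup>2 - CARD('m)"


subsection \<open>Strassen's equations\<close>

text \<open>
  The \<open>(j, i)\<close> cofactor of \<open>M\<close>, which is the \<open>(i, j)\<close> entry of the adjugate, is the
  determinant of \<open>M\<close> with row \<open>j\<close> replaced by the \<open>i\<close>-th unit vector. This form includes the
  sign and needs no order on the index type.
\<close>

definition cofactor :: "'a::comm_ring_1 ^ 'n ^ 'n \<Rightarrow> 'n::finite \<Rightarrow> 'n \<Rightarrow> 'a" where
  "cofactor M j i = det (\<chi> r. if r = j then axis i 1 else row r M)"

definition adjugate :: "'a::comm_ring_1 ^ 'n ^ 'n \<Rightarrow> 'a ^ 'n ^ 'n::finite" where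
  "adjugate M = (\<chi> i j. cofactor M j i)"

text \<open>
  The next definitions are stated for a family \<open>S\<close> of matrices, to be instantiated with
  \<open>T\<^sub>A T\<close>, \<open>T\<^sub>B T\<close> and \<open>T\<^sub>C T\<close>.
\<close>

definition strassen_equations :: "(complex ^ 'm \<Rightarrow> complex ^ 'm ^ 'm::finite) \<Rightarrow> bool" where
  "strassen_equations S \<longleftrightarrow>
     (\<forall>\<alpha> \<alpha>' \<alpha>''. S \<alpha>' ** adjugate (S \<alpha>) ** S \<alpha>'' = S \<alpha>'' ** adjugate (S \<alpha>) ** S \<alpha>')"


subsection \<open>The End-closed equations\<close>

text \<open>
  $\Lambda^n V$ is realised as the space of alternating tensors in $V^{\otimes n}$ (characteristic
  zero), where $v_1 \wedge \dots \wedge v_n = \sum_\sigma \mathrm{sgn}(\sigma)\,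
  v_{\sigma(1)} \otimes \dots \otimes v_{\sigma(n)}$. For $V = \mathbb{C}^I$ a tensor in
  $V^{\otimes n}$ is given by its coordinates at the index lists of length \<open>n\<close>; coordinates at
  lists of any other length are set to 0.
\<close>

definition wedge :: "(complex ^ 'i) list \<Rightarrow> 'i list \<Rightarrow> complex" where
  "wedge vs ix =
     (if length ix = length vs
      then \<Sum>\<sigma> | \<sigma> permutes {..<length vs}.
             of_int (sign \<sigma>) * (\<Prod>t<length vs. (vs ! \<sigma> t) $ (ix ! t))
      else 0)"

text \<open>A matrix, viewed as a vector of $B \otimes C$ (resp. $A \otimes C$, $A \otimes B$)\<close>

definition mat_vec :: "complex ^ 'n ^ 'm \<Rightarrow> complex ^ ('n \<times> 'm)" where
  "mat_vec M = (\<chi> p. M $ snd p $ fst p)"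

definition is_basis :: "(complex ^ 'm::finite) list \<Rightarrow> bool" where
  "is_basis \<alpha>s \<longleftrightarrow> distinct \<alpha>s \<and> vec.independent (set \<alpha>s) \<and> vec.span (set \<alpha>s) = UNIV"

definition end_closed_equations :: "(complex ^ 'm \<Rightarrow> complex ^ 'm ^ 'm::finite) \<Rightarrow> bool" where
  "end_closed_equations S \<longleftrightarrow>
     (\<forall>\<alpha>s \<alpha>' \<alpha>''. is_basis \<alpha>s \<longrightarrow>
        wedge (mat_vec (S \<alpha>' ** adjugate (S (hd \<alpha>s)) ** S \<alpha>'') # map (\<lambda>\<alpha>. mat_vec (S \<alpha>)) \<alpha>s)
          = (\<lambda>_. 0))"

end

theory Submission
  imports Defs
begin

text \<open>
  Elements of \<open>T(A\<^sup>*) \<otimes> A\<close> are the tensors obtained from \<open>T\<close> by letting an endomorphism act on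
  the factor \<open>A\<close>, and likewise for \<open>B\<close> and \<open>C\<close>. For concise \<open>T\<close> each of the three spaces has
  dimension \<open>m\<^sup>2\<close>, and the kernel of the map in the 111-equations is their intersection. So these
  equations say that the intersection has dimension at least \<open>m\<close>
  (\<open>equations111_iff_dim\<close>). An element of the intersection is a triple \<open>(X, Y, Z)\<close> of
  endomorphisms having the same effect on \<open>T\<close>, which for the matrices \<open>S(\<alpha>) = T(\<alpha>)\<close> means
  \<open>Z S(\<alpha>) = S(\<alpha>) Y = S(X \<alpha>)\<close> (up to transposition of \<open>Z\<close>). Left and right multiplication
  commute, hence the matrices \<open>Z\<close> of different triples commute with each other on the
  space \<open>S(A\<^sup>*)\<close>.

  Fix \<open>\<alpha>\<close> and an \<open>m\<close>-dimensional space of such triples, and put \<open>M = S(\<alpha>)\<close>. If \<open>M\<close> is invertible,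
  then \<open>(X, Y, Z) \<mapsto> X \<alpha>\<close> is injective, hence bijective onto \<open>A\<^sup>*\<close>, so \<open>S(A\<^sup>*)\<close> consists of the
  matrices \<open>Z M\<close>, and the product \<open>(Z M) adj(M) (Z' M) = det(M) Z Z' M\<close> is symmetric in \<open>Z\<close>, \<open>Z'\<close>
  and lies in \<open>S(A\<^sup>*)\<close>. If \<open>M\<close> has corank at least two, then \<open>adj(M) = 0\<close>. If \<open>M\<close> has corank one,
  then \<open>adj(M) = u v\<^sup>T\<close> where \<open>u\<close> and \<open>v\<close> span the right and the left kernel of \<open>M\<close>. The map to \<open>A\<^sup>*\<close> is now not
  surjective, as otherwise \<open>u\<close> would be killed by all of \<open>S(A\<^sup>*)\<close>, contradicting conciseness. So
  some nonzero triple has \<open>Z M = M Y = 0\<close>, which forces \<open>Z = c v\<^sup>T\<close> and \<open>Y = u b\<^sup>T\<close> with \<open>b\<close>, \<open>c\<close>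
  nonzero. Then \<open>c (v\<^sup>T S(\<beta>)) = (S(\<beta>) u) b\<^sup>T\<close> for all \<open>\<beta>\<close>, so \<open>S(\<beta>) u\<close> and \<open>v\<^sup>T S(\<beta>)\<close> are the
  same multiple \<open>\<mu>(\<beta>)\<close> of \<open>c\<close> and \<open>b\<^sup>T\<close>, and \<open>S(\<beta>) adj(M) S(\<gamma>) = \<mu>(\<beta>) \<mu>(\<gamma>) c b\<^sup>T\<close> is symmetric. It is
  in \<open>S(A\<^sup>*)\<close> since \<open>\<mu>(\<beta>) c b\<^sup>T = Z S(\<beta>) = S(X \<beta>)\<close> and \<open>\<mu>\<close> is not identically zero. These cases are
  \<open>adjugate_product_invertible\<close> and \<open>adjugate_product_corank_one\<close>, in a locale that applies equally
  to the \<open>A\<close>-, \<open>B\<close>- and \<open>C\<close>-slices. The End-closed equations express membership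
  in \<open>S(A\<^sup>*)\<close>, because a wedge product vanishes exactly on linearly dependent vectors.

  Conversely, suppose that \<open>K = T(\<alpha>\<^sub>0)\<close> is invertible and the \<open>A\<close>-equations hold. Multiplication on the
  left by \<open>T(\<alpha>) adj(K)\<close> is an endomorphism of \<open>C\<close>; by the Strassen equations it has the same effect
  on \<open>T\<close> as the endomorphism \<open>adj(K) T(\<alpha>)\<close> of \<open>B\<close>, and by the End-closed equations the same as
  some endomorphism of \<open>A\<close>. This gives \<open>m\<close> dimensions in the triple intersection
  (\<open>one_A_generic_converse\<close>).
\<close>

section \<open>Matrices and linear maps\<close>

lemma matrix_eq_0I: "(\<And>x. M *v x = 0) \<Longrightarrow> M = (0 :: 'a::semiring_1 ^ 'n ^ 'm)"
  by (simp add: matrix_eq)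

lemma matrix_eq_0I_left:
  fixes M :: "'a::semiring_1 ^ 'n ^ 'm::finite"
  assumes "\<And>x. x v* M = 0"
  shows "M = 0"
proof -
  have "M $ i $ j = (axis i 1 v* M) $ j" for i j
    by (simp add: vector_matrix_mult_def axis_def if_distrib[of "\<lambda>z. z * _"] cong: if_cong)
  then show ?thesis by (simp add: assms vec_eq_iff)
qed

lemma det_nz_iff_full_rank: "det M \<noteq> 0 \<longleftrightarrow> rank M = CARD('n)"
  for M :: "'a::field ^ 'n ^ 'n::finite"
  by (metis invertible_det_nz invertible_left_inverse matrix_left_invertible_span_rows_gen
      row_rank_def_gen vec.dim_eq_full vec.dimension_def card_cart_basis)

lemma mat_matrix_mul: "mat c ** X = (\<chi> i j. c * X $ i $ j)"
  for X :: "'a::comm_semiring_1 ^ 'n ^ 'm"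
  by (simp add: vec_eq_iff matrix_matrix_mult_def mat_def if_distrib[of "\<lambda>z. z * _"] cong: if_cong)

lemma matrix_mul_mat: "X ** mat c = (\<chi> i j. c * X $ i $ j)"
  for X :: "'a::comm_semiring_1 ^ 'n ^ 'm"
  by (simp add: vec_eq_iff matrix_matrix_mult_def mat_def if_distrib[of "\<lambda>z. _ * z"] mult.commute
      cong: if_cong)

lemma zero_matrix_mul: "0 ** X = 0" and matrix_mul_zero: "Y ** 0 = 0"
  by (simp_all add: vec_eq_iff matrix_matrix_mult_def)

lemma inj_mat_vec: "inj mat_vec"
  by (rule injI) (simp add: mat_vec_def vec_eq_iff)

lemma mat_vec_add: "mat_vec (M + N) = mat_vec M + mat_vec N"
  by (simp add: mat_vec_def vec_eq_iff)

lemma mat_vec_scale: "mat_vec (M ** mat c) = c *s mat_vec M"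
  by (simp add: mat_vec_def vec_eq_iff matrix_mul_mat)

lemma vec_linearI:
  fixes f :: "'a::field ^ 'n \<Rightarrow> 'a ^ 'k"
  assumes "\<And>x y. f (x + y) = f x + f y" and "\<And>c x. f (c *s x) = c *s f x"
  shows "Vector_Spaces.linear (*s) (*s) f"
  using assms by (simp only: Vector_Spaces.linear_iff vec.vector_space_axioms simp_thms)

section \<open>The adjugate matrix\<close>

text \<open>
  Both determinants are the sum of the Leibniz terms with \<open>p j = i\<close>. This column form of the cofactor
  makes the adjugate compatible with transposition.
\<close>

lemma cofactor_eq_det_column_replaced:
  fixes M :: "'a::comm_ring_1 ^ 'n ^ 'n::finite"
  shows "cofactor M j i = det (\<chi> r c. if c = i then (if r = j then 1 else 0) else M $ r $ c)"
  unfolding cofactor_def det_def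
proof (rule sum.cong[OF refl])
  fix p assume "p \<in> {p. p permutes (UNIV :: 'n set)}"
  then have p: "inj p" by (simp add: permutes_inj)
  let ?R = "\<lambda>r. (\<chi> r. if r = j then axis i 1 else row r M) $ r $ p r :: 'a"
  let ?C = "\<lambda>r. (\<chi> r c. if c = i then (if r = j then 1 else 0) else M $ r $ c) $ r $ p r"
  have "prod ?R UNIV = prod ?C UNIV"
  proof (cases "p j = i")
    case True
    then have "p r = i \<longleftrightarrow> r = j" for r
      by (metis injD[OF p])
    then have "?R r = ?C r" for r
      by (simp add: axis_def row_def)
    then show ?thesis by (intro prod.cong refl)
  next
    case False
    have "p permutes UNIV" using \<open>p \<in> _\<close> by simp
    then obtain q where q: "p q = i" by (metis permutes_surj surj_def)
    have "prod ?R UNIV = 0"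
      using False by (intro prod_zero[OF finite] bexI[of _ j]) (auto simp: axis_def)
    moreover have "prod ?C UNIV = 0"
      using False q by (intro prod_zero[OF finite] bexI[of _ q]) auto
    ultimately show ?thesis by simp
  qed
  then show "of_int (sign p) * prod ?R UNIV = of_int (sign p) * prod ?C UNIV" by simp
qed

lemma adjugate_transpose: "adjugate (transpose M) = transpose (adjugate M)"
  for M :: "'a::comm_ring_1 ^ 'n ^ 'n::finite"
proof -
  have "cofactor (transpose M) j i = cofactor M i j" for i j
  proof -
    have "cofactor (transpose M) j i
        = det (transpose (\<chi> r c. if c = j then (if r = i then 1 else 0) else M $ r $ c))"
      unfolding cofactor_def
      by (rule arg_cong[where f = det]) (auto simp: vec_eq_iff axis_def row_def transpose_def)
    then show ?thesis by (simp only: det_transpose cofactor_eq_det_column_replaced[symmetric])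
  qed
  then show ?thesis by (simp add: adjugate_def vec_eq_iff transpose_def)
qed

text \<open>
  Laplace expansion: the \<open>(r, s)\<close> entry is the determinant of \<open>M\<close> with row \<open>s\<close> replaced by row \<open>r\<close>,
  by linearity of the determinant in that row.
\<close>

lemma matrix_mul_adjugate: "M ** adjugate M = mat (det M)"
  for M :: "'a::comm_ring_1 ^ 'n ^ 'n::finite"
proof -
  have "(M ** adjugate M) $ r $ s = mat (det M) $ r $ s" for r s
  proof -
    have "(M ** adjugate M) $ r $ s = (\<Sum>i\<in>UNIV. M $ r $ i * cofactor M s i)"
      by (simp add: matrix_matrix_mult_def adjugate_def)
    also have "\<dots> = (\<Sum>i\<in>UNIV. det (\<chi> q. if q = s then M $ r $ i *s axis i 1 else row q M))"
      by (intro sum.cong[OF refl]) (simp add: cofactor_def det_row_mul)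
    also have "\<dots> = det (\<chi> q. if q = s then (\<Sum>i\<in>UNIV. M $ r $ i *s axis i 1) else row q M)"
      by (simp add: det_linear_row_sum)
    also have "(\<Sum>i\<in>UNIV. M $ r $ i *s axis i 1) = row r M"
      by (simp add: basis_expansion row_def)
    also have "det (\<chi> q. if q = s then row r M else row q M) = mat (det M) $ r $ s"
    proof (cases "r = s")
      case True
      then have "(\<chi> q. if q = s then row r M else row q M) = M"
        by (simp add: vec_eq_iff row_def)
      then show ?thesis using True by (simp add: mat_def)
    next
      case False
      then show ?thesis
        by (subst det_identical_rows[of r s]) (auto simp: row_def mat_def vec_eq_iff)
    qed
    finally show ?thesis .
  qed
  then show ?thesis by (simp add: vec_eq_iff)
qed

lemma adjugate_matrix_mul: "adjugate M ** M = mat (det M)"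
  for M :: "'a::comm_ring_1 ^ 'n ^ 'n::finite"
proof -
  have "transpose (adjugate M ** M) = transpose M ** adjugate (transpose M)"
    by (simp add: matrix_transpose_mul adjugate_transpose)
  also have "\<dots> = mat (det M)" by (simp add: matrix_mul_adjugate)
  finally have "transpose (transpose (adjugate M ** M)) = transpose (mat (det M))" by simp
  then show ?thesis by (simp add: transpose_mat)
qed

text \<open>
  A nonzero cofactor says that \<open>M\<close> becomes invertible when row \<open>j\<close> is replaced by the unit vector \<open>i\<close>.
  A kernel vector whose \<open>i\<close>-th coordinate vanishes is still in the kernel of the modified matrix.
  So both kernels of \<open>M\<close> are at most one-dimensional.
\<close>

lemma cofactor_nonzero_kernel:
  fixes M :: "'a::field ^ 'n ^ 'n::finite"
  assumes cof: "cofactor M j i \<noteq> 0"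
  shows "M *v x = 0 \<Longrightarrow> x $ i = 0 \<Longrightarrow> x = 0"
    and "y v* M = 0 \<Longrightarrow> y $ j = 0 \<Longrightarrow> y = 0"
proof -
  define D where "D = (\<chi> r. if r = j then axis i 1 else row r M)"
  have D: "invertible D" using cof by (simp add: invertible_det_nz D_def cofactor_def)
  { assume "M *v x = 0" "x $ i = 0"
    have "(D *v x) $ r = 0" for r
    proof (cases "r = j")
      case True
      then show ?thesis using \<open>x $ i = 0\<close>
        by (simp add: D_def matrix_vector_mult_def axis_def if_distrib[of "\<lambda>z. z * _"] cong: if_cong)
    next
      case False
      then have "(D *v x) $ r = (M *v x) $ r"
        by (simp add: D_def matrix_vector_mult_def row_def)
      then show ?thesis using \<open>M *v x = 0\<close> by simp
    qed
    then have "D *v x = 0" by (simp add: vec_eq_iff)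
    then show "x = 0" using D by (metis invertible_def matrix_left_invertible_ker)
  }
  { assume "y v* M = 0" "y $ j = 0"
    have "(transpose D *v y) $ c = (y v* M) $ c" for c
      using \<open>y $ j = 0\<close> 
      by (auto simp: D_def matrix_vector_mult_def vector_matrix_mult_def transpose_def row_def
          intro!: sum.cong)
    then have "transpose D *v y = 0" using \<open>y v* M = 0\<close> by (simp add: vec_eq_iff)
    moreover have "invertible (transpose D)" using D by (simp add: invertible_det_nz)
    ultimately show "y = 0" by (metis invertible_def matrix_left_invertible_ker)
  }
qed

lemma adjugate_rank_one:
  fixes M :: "'a::field ^ 'n ^ 'n::finite"
  assumes det0: "det M = 0" and nz: "adjugate M \<noteq> 0"
  obtains u v where "u \<noteq> 0" "M *v u = 0"
    and "adjugate M = (\<chi> i j. u $ i * v $ j)"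
    and "\<forall>x. M *v x = 0 \<longrightarrow> (\<exists>c. x = c *s u)"
    and "\<forall>y. y v* M = 0 \<longrightarrow> (\<exists>c. y = c *s v)"
proof -
  define N where "N = adjugate M"
  obtain i j where ij: "N $ i $ j \<noteq> 0" using nz by (auto simp: vec_eq_iff N_def)
  have cof: "cofactor M j i \<noteq> 0" using ij by (simp add: N_def adjugate_def)
  have MN: "M *v column s N = 0" for s
    using matrix_mul_adjugate[of M] det0
    by (simp add: N_def vec_eq_iff matrix_vector_mult_def matrix_matrix_mult_def column_def mat_def)
  have NM: "row r N v* M = 0" for r
    using adjugate_matrix_mul[of M] det0
    by (simp add: N_def vec_eq_iff vector_matrix_mult_def matrix_matrix_mult_def row_def mat_def mult.commute)
  define u where "u = column j N"
  \<comment> \<open>\<open>v\<close> is scaled so that \<open>v $ j = 1\<close>, which makes \<open>adjugate M\<close> exactly \<open>u v\<^sup>T\<close>\<close>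
  define v where "v = inverse (N $ i $ j) *s row i N"
  have u: "u $ i \<noteq> 0" using ij by (simp add: u_def column_def)
  have Mu: "M *v u = 0" using MN by (simp add: u_def)
  have vM: "v v* M = 0"
    using NM[of i] by (simp add: v_def vec_eq_iff vector_matrix_mult_def mult.assoc sum_distrib_left[symmetric])
  have right: "x = (x $ i / u $ i) *s u" if "M *v x = 0" for x
  proof -
    have "x - (x $ i / u $ i) *s u = 0"
    proof (rule cofactor_nonzero_kernel(1)[OF cof])
      show "M *v (x - (x $ i / u $ i) *s u) = 0"
        by (simp add: matrix_vector_mult_diff_distrib vector_scalar_commute that Mu)
      show "(x - (x $ i / u $ i) *s u) $ i = 0" using u by simp
    qed
    then show ?thesis by simp
  qed
  have left: "y = y $ j *s v" if "y v* M = 0" for y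
  proof -
    have "(y - y $ j *s v) v* M = y v* M - y $ j *s (v v* M)"
      by (simp add: vec_eq_iff vector_matrix_mult_def algebra_simps sum_subtractf sum_distrib_left)
    then have "(y - y $ j *s v) v* M = 0" using that vM by simp
    moreover have "(y - y $ j *s v) $ j = 0" using ij by (simp add: v_def row_def)
    ultimately have "y - y $ j *s v = 0" by (rule cofactor_nonzero_kernel(2)[OF cof])
    then show ?thesis by simp
  qed
  have "N $ r $ s = u $ r * v $ s" for r s
  proof -
    have "column s N $ r = ((column s N $ i / u $ i) *s u) $ r" using right[OF MN] by metis
    then show ?thesis by (simp add: v_def row_def column_def u_def field_simps)
  qed
  then have "adjugate M = (\<chi> r s. u $ r * v $ s)" by (simp add: vec_eq_iff N_def)
  moreover have "u \<noteq> 0" using u by auto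
  moreover have "\<forall>x. M *v x = 0 \<longrightarrow> (\<exists>c. x = c *s u)"
    using right by blast
  moreover have "\<forall>y. y v* M = 0 \<longrightarrow> (\<exists>c. y = c *s v)"
    using left by blast
  ultimately show thesis using Mu by (intro that)
qed

section \<open>Wedge products and linear independence\<close>

text \<open>
  Composing with the transposition of the two equal positions is a sign-reversing involution on the
  terms.
\<close>

lemma wedge_eq_0_if_repeated:
  assumes ab: "a < length vs" "b < length vs" "a \<noteq> b" and eq: "vs ! a = vs ! b"
  shows "wedge vs ix = 0"
proof (cases "length ix = length vs")
  case True
  let ?n = "length vs"
  let ?P = "{\<sigma>. \<sigma> permutes {..<?n}}"
  let ?\<tau> = "Transposition.transpose a b"
  let ?f = "\<lambda>\<sigma>. of_int (sign \<sigma>) * (\<Prod>t<?n. (vs ! \<sigma> t) $ (ix ! t)) :: complex"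
  have \<tau>: "?\<tau> permutes {..<?n}" using ab by (intro permutes_swap_id) auto
  have "sum ?f ?P = (\<Sum>\<sigma>\<in>?P. - ?f \<sigma>)"
  proof (rule sum.reindex_bij_witness[where i = "\<lambda>\<sigma>. ?\<tau> \<circ> \<sigma>" and j = "\<lambda>\<sigma>. ?\<tau> \<circ> \<sigma>"])
    fix \<sigma> assume "\<sigma> \<in> ?P"
    then have \<sigma>: "\<sigma> permutes {..<?n}" by simp
    show "?\<tau> \<circ> (?\<tau> \<circ> \<sigma>) = \<sigma>" by (simp add: fun_eq_iff)
    then show "?\<tau> \<circ> (?\<tau> \<circ> \<sigma>) = \<sigma>" .
    show "?\<tau> \<circ> \<sigma> \<in> ?P" using \<sigma> \<tau> by (simp add: permutes_compose)
    then show "?\<tau> \<circ> \<sigma> \<in> ?P" .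
    have "sign (?\<tau> \<circ> \<sigma>) = - sign \<sigma>"
      using ab(3) \<sigma>
      by (simp add: sign_compose permutation_swap_id permutes_imp_permutation[OF finite_lessThan]
          sign_swap_id)
    moreover have "vs ! (?\<tau> t) = vs ! t" for t
      using eq by (simp add: Transposition.transpose_def)
    ultimately show "- ?f (?\<tau> \<circ> \<sigma>) = ?f \<sigma>" by simp
  qed
  also have "\<dots> = - sum ?f ?P" by (rule sum_negf)
  finally have "sum ?f ?P = 0" by simp
  then show ?thesis using True by (simp add: wedge_def)
qed (simp add: wedge_def)

lemma wedge_Cons_sum:
  assumes "finite A"
  shows "wedge ((\<Sum>s\<in>A. c s *s g s) # vs) ix = (\<Sum>s\<in>A. c s * wedge (g s # vs) ix)"
proof (cases "length ix = Suc (length vs)")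
  case True
  let ?n = "Suc (length vs)"
  let ?P = "{\<sigma>. \<sigma> permutes {..<?n}}"
  let ?rest = "\<lambda>\<sigma> t. (vs ! (\<sigma> t - 1)) $ (ix ! t)"
  \<comment> \<open>the vector \<open>w\<close> occurs exactly once in each term, at the position that \<open>\<sigma>\<close> sends to \<open>0\<close>\<close>
  have prod: "(\<Prod>t<?n. ((w # vs) ! \<sigma> t) $ (ix ! t))
      = w $ (ix ! inv \<sigma> 0) * (\<Prod>t\<in>{..<?n} - {inv \<sigma> 0}. ?rest \<sigma> t)"
    if "\<sigma> \<in> ?P" for w \<sigma>
  proof -
    from that have \<sigma>: "\<sigma> permutes {..<?n}" by simp
    have mem: "inv \<sigma> 0 \<in> {..<?n}"
      using permutes_in_image[OF permutes_inv[OF \<sigma>], of 0] by simp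
    have "(\<Prod>t<?n. ((w # vs) ! \<sigma> t) $ (ix ! t)) = ((w # vs) ! \<sigma> (inv \<sigma> 0)) $ (ix ! inv \<sigma> 0)
        * (\<Prod>t\<in>{..<?n} - {inv \<sigma> 0}. ((w # vs) ! \<sigma> t) $ (ix ! t))"
      by (rule prod.remove[OF finite_lessThan mem])
    also have "\<sigma> (inv \<sigma> 0) = 0" by (rule permutes_inverses(1)[OF \<sigma>])
    also have "(\<Prod>t\<in>{..<?n} - {inv \<sigma> 0}. ((w # vs) ! \<sigma> t) $ (ix ! t))
        = (\<Prod>t\<in>{..<?n} - {inv \<sigma> 0}. ?rest \<sigma> t)"
    proof (rule prod.cong[OF refl])
      fix t assume "t \<in> {..<?n} - {inv \<sigma> 0}"
      then have "\<sigma> t \<noteq> 0" using permutes_inverses(2)[OF \<sigma>, of t] by (metis DiffD2 singletonI)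
      then show "((w # vs) ! \<sigma> t) $ (ix ! t) = ?rest \<sigma> t" by (simp add: nth_Cons')
    qed
    finally show ?thesis by simp
  qed
  have wedge: "wedge (w # vs) ix = (\<Sum>\<sigma>\<in>?P. of_int (sign \<sigma>) * (w $ (ix ! inv \<sigma> 0)
      * (\<Prod>t\<in>{..<?n} - {inv \<sigma> 0}. ?rest \<sigma> t)))" for w
  proof -
    have "wedge (w # vs) ix = (\<Sum>\<sigma>\<in>?P. of_int (sign \<sigma>) * (\<Prod>t<?n. ((w # vs) ! \<sigma> t) $ (ix ! t)))"
      using True by (simp add: wedge_def del: prod.lessThan_Suc)
    also have "\<dots> = (\<Sum>\<sigma>\<in>?P. of_int (sign \<sigma>) * (w $ (ix ! inv \<sigma> 0)
        * (\<Prod>t\<in>{..<?n} - {inv \<sigma> 0}. ?rest \<sigma> t)))"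
      by (intro sum.cong refl) (simp only: prod)
    finally show ?thesis .
  qed
  show ?thesis
    unfolding wedge sum_distrib_left
    by (subst sum.swap) (simp add: sum_distrib_right sum_distrib_left ac_simps)
qed (simp add: wedge_def)

lemma wedge_eq_0_if_in_span:
  assumes "v \<in> vec.span (set vs)"
  shows "wedge (v # vs) ix = 0"
proof -
  obtain u where v: "v = (\<Sum>w\<in>set vs. u w *s w)"
    using assms by (auto simp: vec.span_finite)
  have "wedge (w # vs) ix = 0" if w: "w \<in> set vs" for w
  proof -
    obtain t where "t < length vs" "vs ! t = w" using w by (auto simp: in_set_conv_nth)
    then show ?thesis by (intro wedge_eq_0_if_repeated[of 0 _ "Suc t"]) auto
  qed
  then show ?thesis unfolding v by (simp add: wedge_Cons_sum)
qed

text \<open>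
  Contracting \<open>v\<^sub>1 \<and> \<dots> \<and> v\<^sub>n\<close> with functionals \<open>\<phi>\<^sub>1, \<dots>, \<phi>\<^sub>n\<close> gives the determinant of the matrix
  \<open>(\<phi>\<^sub>s(v\<^sub>t))\<close>, which is \<open>1\<close> for a dual family of functionals.
\<close>

lemma wedge_nonzero_if_independent:
  fixes vs :: "(complex ^ 'i) list"
  assumes dist: "distinct vs" and indep: "vec.independent (set vs)"
  shows "wedge vs \<noteq> (\<lambda>_. 0)"
proof
  assume zero: "wedge vs = (\<lambda>_. 0)"
  let ?n = "length vs"
  have "\<exists>\<phi> :: 'i \<Rightarrow> complex. \<forall>t<?n. (\<Sum>i\<in>UNIV. \<phi> i * vs ! t $ i) = (if t = s then 1 else 0)"
    if s: "s < ?n" for s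
  proof -
    \<comment> \<open>the dual functional is one row of an endomorphism that extends the assignment sending \<open>vs ! s\<close> to a unit vector and the other members of \<open>vs\<close> to \<open>0\<close>\<close>
    fix i\<^sub>0 :: 'i
    obtain g :: "complex ^ 'i \<Rightarrow> complex ^ 'i" where g: "Vector_Spaces.linear (*s) (*s) g"
      and gv: "\<And>v. v \<in> set vs \<Longrightarrow> g v = (if v = vs ! s then axis i\<^sub>0 1 else 0)"
      using vec.linear_independent_extend[OF indep, of "\<lambda>v. if v = vs ! s then axis i\<^sub>0 1 else 0"]
      by blast
    have "(\<Sum>i\<in>UNIV. matrix g $ i\<^sub>0 $ i * vs ! t $ i) = g (vs ! t) $ i\<^sub>0" for t
      using matrix_works[OF g, of "vs ! t"] by (simp add: matrix_vector_mult_def vec_eq_iff)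
    then show ?thesis
      using gv nth_eq_iff_index_eq[OF dist] s
      by (intro exI[of _ "\<lambda>i. matrix g $ i\<^sub>0 $ i"]) (simp add: axis_def)
  qed
  then obtain \<phi> :: "nat \<Rightarrow> 'i \<Rightarrow> complex" where
    \<phi>: "\<And>s t. s < ?n \<Longrightarrow> t < ?n \<Longrightarrow> (\<Sum>i\<in>UNIV. \<phi> s i * vs ! t $ i) = (if t = s then 1 else 0)"
    by metis
  let ?P = "{\<sigma>. \<sigma> permutes {..<?n}}"
  let ?G = "PiE {..<?n} (\<lambda>_. UNIV :: 'i set)"
  have "(\<Sum>\<sigma>\<in>?P. of_int (sign \<sigma>) * (\<Prod>t<?n. \<Sum>i\<in>UNIV. \<phi> t i * vs ! \<sigma> t $ i))
      = (\<Sum>\<sigma>\<in>?P. \<Sum>g\<in>?G. of_int (sign \<sigma>) * (\<Prod>t<?n. \<phi> t (g t) * vs ! \<sigma> t $ g t))"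
    by (simp add: prod_sum_PiE sum_distrib_left)
  also have "\<dots> = (\<Sum>g\<in>?G. \<Sum>\<sigma>\<in>?P. of_int (sign \<sigma>) * (\<Prod>t<?n. \<phi> t (g t) * vs ! \<sigma> t $ g t))"
    by (rule sum.swap)
  also have "\<dots> = (\<Sum>g\<in>?G. (\<Prod>t<?n. \<phi> t (g t)) * wedge vs (map g [0..<?n]))"
    by (simp add: wedge_def prod.distrib sum_distrib_left ac_simps)
  also have "\<dots> = 0" by (simp add: zero)
  finally have "(\<Sum>\<sigma>\<in>?P. of_int (sign \<sigma>) * (\<Prod>t<?n. \<Sum>i\<in>UNIV. \<phi> t i * vs ! \<sigma> t $ i)) = (0 :: complex)" .
  moreover have "(\<Sum>\<sigma>\<in>?P. of_int (sign \<sigma>) * (\<Prod>t<?n. \<Sum>i\<in>UNIV. \<phi> t i * vs ! \<sigma> t $ i))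
      = (\<Sum>\<sigma>\<in>?P. if \<sigma> = id then 1 else 0 :: complex)"
  proof (rule sum.cong[OF refl])
    fix \<sigma> assume "\<sigma> \<in> ?P"
    then have \<sigma>: "\<sigma> permutes {..<?n}" by simp
    then have lt: "\<sigma> t < ?n" if "t < ?n" for t
      using permutes_in_image[OF \<sigma>, of t] that by simp
    then have "(\<Prod>t<?n. \<Sum>i\<in>UNIV. \<phi> t i * vs ! \<sigma> t $ i) = (\<Prod>t<?n. if \<sigma> t = t then 1 else 0)"
      by (intro prod.cong) (auto simp: \<phi>)
    also have "\<dots> = (if \<sigma> = id then 1 else 0)"
    proof (cases "\<sigma> = id")
      case False
      then obtain t where t: "\<sigma> t \<noteq> t" by (auto simp: fun_eq_iff)
      then have "t < ?n" using permutes_not_in[OF \<sigma>, of t] by auto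
      then have "(\<Prod>t<?n. if \<sigma> t = t then 1 else 0 :: complex) = 0"
        using t by (intro prod_zero) auto
      then show ?thesis using False by simp
    qed simp
    finally show "of_int (sign \<sigma>) * (\<Prod>t<?n. \<Sum>i\<in>UNIV. \<phi> t i * vs ! \<sigma> t $ i)
        = (if \<sigma> = id then 1 else 0 :: complex)" by (simp add: sign_id)
  qed
  moreover have "\<dots> = 1"
    by (subst sum.delta) (simp_all add: finite_permutations permutes_id)
  ultimately show False by simp
qed

lemma wedge_Cons_eq_0_iff:
  assumes "distinct vs" and "vec.independent (set vs)"
  shows "wedge (v # vs) = (\<lambda>_. 0) \<longleftrightarrow> v \<in> vec.span (set vs)"
proof
  assume "wedge (v # vs) = (\<lambda>_. 0)"
  then have dep: "\<not> (distinct (v # vs) \<and> vec.independent (set (v # vs)))"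
    using wedge_nonzero_if_independent by blast
  show "v \<in> vec.span (set vs)"
  proof (rule ccontr)
    assume v: "v \<notin> vec.span (set vs)"
    then have "v \<notin> set vs" by (auto intro: vec.span_base)
    then show False using dep assms vec.independent_insertI[OF v] by simp
  qed
next
  assume "v \<in> vec.span (set vs)"
  then show "wedge (v # vs) = (\<lambda>_. 0)" by (intro ext wedge_eq_0_if_in_span)
qed

text \<open>
  An injective linear \<open>S\<close> maps a basis to independent vectors spanning its range, so the wedge product
  with them tests membership in that range.
\<close>

lemma end_closed_iff_in_range:
  fixes S :: "complex ^ 'm \<Rightarrow> complex ^ 'm ^ 'm::finite"
  assumes lin: "Vector_Spaces.linear (*s) (*s) (\<lambda>\<alpha>. mat_vec (S \<alpha>))" and inj: "inj S"
    and basis: "is_basis \<alpha>s"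
  shows "wedge (mat_vec M # map (\<lambda>\<alpha>. mat_vec (S \<alpha>)) \<alpha>s) = (\<lambda>_. 0) \<longleftrightarrow> M \<in> range S"
proof -
  let ?f = "\<lambda>\<alpha>. mat_vec (S \<alpha>)"
  have f: "inj ?f" using inj_compose[OF inj_mat_vec inj] by (simp add: o_def)
  have "distinct (map ?f \<alpha>s)"
    using basis f by (auto simp: is_basis_def distinct_map intro: inj_on_subset)
  moreover have "vec.independent (set (map ?f \<alpha>s))"
    using basis f vec.linear_independent_injective_image[OF lin, of "set \<alpha>s"]
    by (auto simp: is_basis_def)
  ultimately have "wedge (mat_vec M # map ?f \<alpha>s) = (\<lambda>_. 0)
      \<longleftrightarrow> mat_vec M \<in> vec.span (?f ` set \<alpha>s)"
    by (simp add: wedge_Cons_eq_0_iff)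
  also have "vec.span (?f ` set \<alpha>s) = range ?f"
    using vec.linear_span_image[OF lin, of "set \<alpha>s"] basis by (simp add: is_basis_def)
  also have "mat_vec M \<in> range ?f \<longleftrightarrow> M \<in> range S"
    using injD[OF inj_mat_vec] by fastforce
  finally show ?thesis .
qed

section \<open>Commuting families acting on a space of matrices\<close>

text \<open>
  \<open>S\<close> stands for one of the three slice maps of a concise tensor. The parameter \<open>a\<close> runs over the
  coordinates of an \<open>m\<close>-dimensional space of triples of endomorphisms with equal effect on the tensor;
  \<open>P a\<close>, \<open>L a\<close> and \<open>Q a\<close> are the members of the triple, acting on the argument of \<open>S\<close>, on the rows and
  on the columns. Linearity in \<open>a\<close> is stated for the common effect; as \<open>S\<close> is
  injective, it passes to \<open>a \<mapsto> P a *v \<alpha>\<close>.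
\<close>

locale family_111 =
  fixes S P L Q :: "complex ^ 'm \<Rightarrow> complex ^ 'm ^ 'm::finite"
  assumes S_linear: "Vector_Spaces.linear (*s) (*s) (\<lambda>\<alpha>. mat_vec (S \<alpha>))"
    and S_inj: "inj S"
    and S_nondegenerate: "(\<And>\<alpha>. S \<alpha> *v u = 0) \<Longrightarrow> u = 0"
    and left: "L a ** S \<alpha> = S (P a *v \<alpha>)"
    and right: "S \<alpha> ** Q a = S (P a *v \<alpha>)"
    and action_linear: "Vector_Spaces.linear (*s) (*s) (\<lambda>a. mat_vec (S (P a *v \<alpha>)))"
    and L_eq_0: "L a = 0 \<Longrightarrow> a = 0"
    and Q_eq_0: "Q a = 0 \<Longrightarrow> a = 0"
begin

lemma S_add: "S (\<alpha> + \<beta>) = S \<alpha> + S \<beta>"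
  using vec.linear_add[OF S_linear] by (metis mat_vec_add injD[OF inj_mat_vec])

lemma S_scale: "S (c *s \<alpha>) = S \<alpha> ** mat c"
  using vec.linear_scale[OF S_linear] by (metis mat_vec_scale injD[OF inj_mat_vec])

lemma S_0: "S 0 = 0"
  using S_add[of 0 0] by simp

text \<open>
  On the image of \<open>S\<close>, multiplying by \<open>L b\<close> on the left is multiplying by \<open>Q b\<close> on the right, and
  this commutes with left multiplication by \<open>L a\<close>.
\<close>

lemma left_commute: "L a ** (L b ** S \<alpha>) = L b ** (L a ** S \<alpha>)"
proof -
  have "L a ** (L b ** S \<alpha>) = (L a ** S \<alpha>) ** Q b"
    by (simp only: left right[symmetric] matrix_mul_assoc)
  also have "\<dots> = L b ** (L a ** S \<alpha>)"
    by (simp only: left right)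
  finally show ?thesis .
qed

lemma orbit_linear: "Vector_Spaces.linear (*s) (*s) (\<lambda>a. P a *v \<alpha>)"
proof -
  have eq: "x = y" if "mat_vec (S x) = mat_vec (S y)" for x y
    using injD[OF S_inj injD[OF inj_mat_vec that]] .
  have "P (a + b) *v \<alpha> = P a *v \<alpha> + P b *v \<alpha>" for a b
    by (rule eq) (simp only: vec.linear_add[OF action_linear] S_add mat_vec_add)
  moreover have "P (c *s a) *v \<alpha> = c *s (P a *v \<alpha>)" for c a
    by (rule eq) (simp only: vec.linear_scale[OF action_linear] S_scale mat_vec_scale)
  ultimately show ?thesis
    by (rule vec_linearI)
qed

text \<open>
  The map \<open>a \<mapsto> P a *v \<alpha>\<close> is injective because \<open>L a ** S \<alpha>\<close> determines \<open>L a\<close>. So it is onto and every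
  matrix of the family is \<open>L a ** S \<alpha>\<close> for some \<open>a\<close>; the product becomes \<open>det (S \<alpha>)\<close> times
  \<open>L a ** L b ** S \<alpha>\<close>.
\<close>

lemma adjugate_product_invertible:
  assumes d: "det (S \<alpha>) \<noteq> 0"
  shows "S \<alpha>' ** adjugate (S \<alpha>) ** S \<alpha>'' = S \<alpha>'' ** adjugate (S \<alpha>) ** S \<alpha>'"
    and "S \<alpha>' ** adjugate (S \<alpha>) ** S \<alpha>'' \<in> range S"
proof -
  let ?M = "S \<alpha>"
  have "a = 0" if "P a *v \<alpha> = 0" for a
  proof -
    have "L a ** mat (det ?M) = L a ** ?M ** adjugate ?M"
      by (simp only: matrix_mul_adjugate[symmetric] matrix_mul_assoc)
    also have "L a ** ?M = 0" using that by (simp add: left S_0)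
    finally have "L a = 0"
      using d by (simp add: zero_matrix_mul matrix_mul_mat vec_eq_iff)
    then show ?thesis by (rule L_eq_0)
  qed
  then have "inj (\<lambda>a. P a *v \<alpha>)"
    by (simp add: vec.linear_inj_iff_eq_0[OF orbit_linear])
  then have surj: "surj (\<lambda>a. P a *v \<alpha>)"
    by (rule vec.linear_inj_imp_surj[OF orbit_linear])
  have product: "S (P a *v \<alpha>) ** adjugate ?M ** S \<beta> = L a ** S \<beta> ** mat (det ?M)" for a \<beta>
  proof -
    have "S (P a *v \<alpha>) ** adjugate ?M ** S \<beta> = L a ** ((?M ** adjugate ?M) ** S \<beta>)"
      by (simp only: left[symmetric] matrix_mul_assoc)
    also have "(?M ** adjugate ?M) ** S \<beta> = S \<beta> ** mat (det ?M)"
      by (simp add: matrix_mul_adjugate mat_matrix_mul matrix_mul_mat)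
    finally show ?thesis by (simp only: matrix_mul_assoc)
  qed
  obtain a b where ab: "\<alpha>' = P a *v \<alpha>" "\<alpha>'' = P b *v \<alpha>"
    using surjD[OF surj, of \<alpha>'] surjD[OF surj, of \<alpha>''] by blast
  show "S \<alpha>' ** adjugate ?M ** S \<alpha>'' = S \<alpha>'' ** adjugate ?M ** S \<alpha>'"
    unfolding ab product using left_commute[of a b \<alpha>] by (simp only: left)
  show "S \<alpha>' ** adjugate ?M ** S \<alpha>'' \<in> range S"
    unfolding ab product by (simp add: left S_scale[symmetric])
qed

text \<open>
  Here \<open>a \<mapsto> P a *v \<alpha>\<close> cannot be onto, for then the kernel of \<open>S \<alpha>\<close> would be annihilated by the whole
  family. An \<open>a \<noteq> 0\<close> in its kernel makes both \<open>L a\<close> and \<open>Q a\<close> matrices of rank one, and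
  comparing \<open>L a ** S \<beta>\<close> with \<open>S \<beta> ** Q a\<close> shows that every product in question is a multiple of a
  single matrix.
\<close>

lemma adjugate_product_corank_one:
  assumes det0: "det (S \<alpha>) = 0" and nz: "adjugate (S \<alpha>) \<noteq> 0"
  shows "S \<alpha>' ** adjugate (S \<alpha>) ** S \<alpha>'' = S \<alpha>'' ** adjugate (S \<alpha>) ** S \<alpha>'"
    and "S \<alpha>' ** adjugate (S \<alpha>) ** S \<alpha>'' \<in> range S"
proof -
  let ?M = "S \<alpha>"
  obtain u v where u: "u \<noteq> 0" "?M *v u = 0"
    and uv: "adjugate ?M = (\<chi> i j. u $ i * v $ j)"
    and ker: "\<forall>x. ?M *v x = 0 \<longrightarrow> (\<exists>c. x = c *s u)"
    and lker: "\<forall>y. y v* ?M = 0 \<longrightarrow> (\<exists>c. y = c *s v)"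
    by (rule adjugate_rank_one[OF det0 nz])
  obtain \<alpha>\<^sub>0 where \<alpha>\<^sub>0: "S \<alpha>\<^sub>0 *v u \<noteq> 0" using S_nondegenerate u(1) by blast
  have "\<not> surj (\<lambda>a. P a *v \<alpha>)"
  proof
    assume surj: "surj (\<lambda>a. P a *v \<alpha>)"
    obtain a where "\<alpha>\<^sub>0 = P a *v \<alpha>" using surjD[OF surj, of \<alpha>\<^sub>0] by blast
    then have "S \<alpha>\<^sub>0 *v u = L a *v (?M *v u)"
      by (simp add: left[symmetric] matrix_vector_mul_assoc)
    then show False using \<alpha>\<^sub>0 u(2) by simp
  qed
  then have "\<not> inj (\<lambda>a. P a *v \<alpha>)"
    using vec.linear_inj_imp_surj[OF orbit_linear] by blast
  then obtain a where a: "a \<noteq> 0" "P a *v \<alpha> = 0"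
    by (auto simp: vec.linear_inj_iff_eq_0[OF orbit_linear])
  have "row k (L a) v* ?M = 0" for k
  proof -
    have "(row k (L a) v* ?M) $ j = (L a ** ?M) $ k $ j" for j
      by (simp add: vector_matrix_mult_def matrix_matrix_mult_def row_def mult.commute)
    then show ?thesis using a(2) by (simp add: left S_0 vec_eq_iff)
  qed
  then have "\<forall>k. \<exists>c. row k (L a) = c *s v" using lker by blast
  then obtain c where c: "\<forall>k. row k (L a) = c k *s v" by (rule choice[THEN exE])
  have "?M *v column j (Q a) = 0" for j
  proof -
    have "(?M *v column j (Q a)) $ k = (?M ** Q a) $ k $ j" for k
      by (simp add: matrix_vector_mult_def matrix_matrix_mult_def column_def)
    then show ?thesis using a(2) by (simp add: right S_0 vec_eq_iff)
  qed
  then have "\<forall>j. \<exists>b. column j (Q a) = b *s u" using ker by blast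
  then obtain b where b: "\<forall>j. column j (Q a) = b j *s u" by (rule choice[THEN exE])
  have Lcv: "L a $ k $ j = c k * v $ j" for k j
    using c by (simp add: row_def vec_eq_iff)
  have Qub: "Q a $ k $ j = u $ k * b j" for k j
    using b by (simp add: column_def vec_eq_iff mult.commute)
  obtain k\<^sub>0 where k0: "c k\<^sub>0 \<noteq> 0"
    using Lcv L_eq_0[of a] a(1) by (force simp: vec_eq_iff)
  obtain j\<^sub>0 where j0: "b j\<^sub>0 \<noteq> 0"
    using Qub Q_eq_0[of a] a(1) by (force simp: vec_eq_iff)
  have L_entry: "(L a ** S \<beta>) $ k $ j = c k * (v v* S \<beta>) $ j" for \<beta> k j
    by (simp add: matrix_matrix_mult_def vector_matrix_mult_def Lcv sum_distrib_left ac_simps)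
  have key: "c k * (v v* S \<beta>) $ j = (S \<beta> *v u) $ k * b j" for \<beta> k j
  proof -
    have "c k * (v v* S \<beta>) $ j = (L a ** S \<beta>) $ k $ j"
      by (simp only: L_entry)
    also have "\<dots> = (S \<beta> ** Q a) $ k $ j" by (simp only: left right)
    also have "\<dots> = (S \<beta> *v u) $ k * b j"
      by (simp add: matrix_matrix_mult_def matrix_vector_mult_def Qub sum_distrib_left sum_distrib_right ac_simps)
    finally show ?thesis .
  qed
  define \<mu> where "\<mu> \<beta> = (v v* S \<beta>) $ j\<^sub>0 / b j\<^sub>0" for \<beta>
  have x: "(S \<beta> *v u) $ k = \<mu> \<beta> * c k" for \<beta> k
    using key[of k \<beta> j\<^sub>0] j0 by (simp add: \<mu>_def field_simps)
  have y: "(v v* S \<beta>) $ j = \<mu> \<beta> * b j" for \<beta> j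
    using key[of k\<^sub>0 \<beta> j] k0 by (simp add: x)
  have product: "S \<beta> ** adjugate ?M ** S \<gamma> = (\<chi> k j. \<mu> \<beta> * \<mu> \<gamma> * (c k * b j))" for \<beta> \<gamma>
  proof -
    have "(S \<beta> ** adjugate ?M ** S \<gamma>) $ k $ j = (S \<beta> *v u) $ k * (v v* S \<gamma>) $ j" for k j
      by (simp add: uv matrix_matrix_mult_def matrix_vector_mult_def vector_matrix_mult_def
          sum_distrib_left sum_distrib_right ac_simps)
    then show ?thesis by (simp add: x y vec_eq_iff)
  qed
  show "S \<alpha>' ** adjugate ?M ** S \<alpha>'' = S \<alpha>'' ** adjugate ?M ** S \<alpha>'"
    by (simp add: product mult.commute)
  have "\<mu> \<alpha>\<^sub>0 \<noteq> 0" using \<alpha>\<^sub>0 x[of \<alpha>\<^sub>0] by (auto simp: vec_eq_iff)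
  then have "S \<alpha>' ** adjugate ?M ** S \<alpha>'' = L a ** S \<alpha>\<^sub>0 ** mat (\<mu> \<alpha>' * \<mu> \<alpha>'' / \<mu> \<alpha>\<^sub>0)"
    by (simp add: product matrix_mul_mat vec_eq_iff L_entry y)
  then show "S \<alpha>' ** adjugate ?M ** S \<alpha>'' \<in> range S"
    by (simp add: left S_scale[symmetric])
qed

lemma adjugate_product:
  shows adjugate_product_commute:
      "S \<alpha>' ** adjugate (S \<alpha>) ** S \<alpha>'' = S \<alpha>'' ** adjugate (S \<alpha>) ** S \<alpha>'"
    and adjugate_product_in_range: "S \<alpha>' ** adjugate (S \<alpha>) ** S \<alpha>'' \<in> range S"
proof -
  consider "det (S \<alpha>) \<noteq> 0" | "det (S \<alpha>) = 0" "adjugate (S \<alpha>) \<noteq> 0" | "adjugate (S \<alpha>) = 0"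
    by blast
  then have "S \<alpha>' ** adjugate (S \<alpha>) ** S \<alpha>'' = S \<alpha>'' ** adjugate (S \<alpha>) ** S \<alpha>'
      \<and> S \<alpha>' ** adjugate (S \<alpha>) ** S \<alpha>'' \<in> range S"
  proof cases
    case 1
    then show ?thesis using adjugate_product_invertible by blast
  next
    case 2
    then show ?thesis using adjugate_product_corank_one by blast
  next
    case 3
    then show ?thesis
      by (metis zero_matrix_mul matrix_mul_zero S_0 rangeI)
  qed
  then show "S \<alpha>' ** adjugate (S \<alpha>) ** S \<alpha>'' = S \<alpha>'' ** adjugate (S \<alpha>) ** S \<alpha>'"
    and "S \<alpha>' ** adjugate (S \<alpha>) ** S \<alpha>'' \<in> range S" by blast+
qed

text \<open>
  Membership of the adjugate products in the range of \<open>S\<close> is the End-closed condition for every basis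
  of the parameter space at once.
\<close>

lemma equations_of_family:
  shows "strassen_equations S" and "end_closed_equations S"
  unfolding strassen_equations_def end_closed_equations_def
  using adjugate_product_commute adjugate_product_in_range
  by (auto simp: end_closed_iff_in_range[OF S_linear S_inj])

end

section \<open>Dimension counts\<close>

text \<open>
  The image is the sum of the three embedded subspaces \<open>{(x, 0)}\<close>, \<open>{(- y, y)}\<close> and \<open>{(0, - z)}\<close> of the
  product. The first two are independent, and their sum meets the third in a copy of the triple
  intersection.
\<close>

lemma dim_map111_image:
  fixes U V W :: "'m::finite tensor set"
  assumes U: "vec.subspace U" and V: "vec.subspace V" and W: "vec.subspace W"
  shows "vec_prod.p.dim (map111 ` (U \<times> V \<times> W)) + vec.dim (U \<inter> V \<inter> W)
      = vec.dim U + vec.dim V + vec.dim W"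
proof -
  interpret emb: finite_dimensional_vector_space_pair_1
    "(*s) :: complex \<Rightarrow> 'm tensor \<Rightarrow> 'm tensor" cart_basis
    "vec_prod.scale :: complex \<Rightarrow> 'm tensor \<times> 'm tensor \<Rightarrow> 'm tensor \<times> 'm tensor"
    by unfold_locales
  let ?f = "\<lambda>x. (x, 0) :: 'm tensor \<times> 'm tensor"
  let ?g = "\<lambda>y. (- y, y) :: 'm tensor \<times> 'm tensor"
  let ?h = "\<lambda>z. (0, - z) :: 'm tensor \<times> 'm tensor"
  have linear: "Vector_Spaces.linear (*s) vec_prod.scale ?f"
    "Vector_Spaces.linear (*s) vec_prod.scale ?g"
    "Vector_Spaces.linear (*s) vec_prod.scale ?h"
    by (simp_all add: Vector_Spaces.linear_iff vec.vector_space_axioms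
        vec_prod.p.vector_space_axioms vec_prod.scale_def)
  have dims: "vec_prod.p.dim (?f ` A) = vec.dim A" "vec_prod.p.dim (?g ` A) = vec.dim A"
    "vec_prod.p.dim (?h ` A) = vec.dim A" for A
    by (rule emb.dim_image_eq[OF linear(1)] emb.dim_image_eq[OF linear(2)]
        emb.dim_image_eq[OF linear(3)]; simp add: inj_on_def)+
  have sub: "vec_prod.p.subspace (?f ` U)" "vec_prod.p.subspace (?g ` V)"
    "vec_prod.p.subspace (?h ` W)"
    using emb.linear_subspace_image[OF linear(1) U] emb.linear_subspace_image[OF linear(2) V]
      emb.linear_subspace_image[OF linear(3) W] .
  let ?UV = "{x + y | x y. x \<in> ?f ` U \<and> y \<in> ?g ` V}"
  have "?f ` U \<inter> ?g ` V = {(0, 0)}"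
    using vec.subspace_0[OF U] vec.subspace_0[OF V] by auto
  then have UV: "vec_prod.p.dim ?UV = vec.dim U + vec.dim V"
    using vec_prod.p.dim_sums_Int[OF sub(1,2)]
    by (simp add: dims zero_prod_def[symmetric])
  have "?UV \<inter> ?h ` W = ?h ` (U \<inter> V \<inter> W)"
  proof (intro equalityI subsetI)
    fix q assume "q \<in> ?UV \<inter> ?h ` W"
    then obtain x y z where "x \<in> U" "y \<in> V" "z \<in> W" "q = (x - y, y)" "q = (0, - z)"
      by auto
    then have "- z \<in> U \<inter> V \<inter> W" "q = ?h z"
      using vec.subspace_neg[OF W] by auto
    then show "q \<in> ?h ` (U \<inter> V \<inter> W)"
      using vec.subspace_neg[OF U, of "- z"] vec.subspace_neg[OF V, of "- z"] \<open>z \<in> W\<close> by auto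
  next
    fix q assume "q \<in> ?h ` (U \<inter> V \<inter> W)"
    then obtain z where z: "z \<in> U" "z \<in> V" "z \<in> W" "q = ?h z" by auto
    then have "q = ?f (- z) + ?g (- z)" by simp
    then show "q \<in> ?UV \<inter> ?h ` W"
      using z vec.subspace_neg[OF U, of z] vec.subspace_neg[OF V, of z] by blast
  qed
  moreover have "vec_prod.p.dim {x + y | x y. x \<in> ?UV \<and> y \<in> ?h ` W}
      + vec_prod.p.dim (?UV \<inter> ?h ` W) = vec_prod.p.dim ?UV + vec_prod.p.dim (?h ` W)"
    by (rule vec_prod.p.dim_sums_Int[OF vec_prod.p.subspace_sums[OF sub(1,2)] sub(3)])
  moreover have "{x + y | x y. x \<in> ?UV \<and> y \<in> ?h ` W} = map111 ` (U \<times> V \<times> W)"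
  proof (intro equalityI subsetI)
    fix q assume "q \<in> {x + y | x y. x \<in> ?UV \<and> y \<in> ?h ` W}"
    then obtain x y z where "x \<in> U" "y \<in> V" "z \<in> W" "q = (x - y, y - z)" by auto
    then show "q \<in> map111 ` (U \<times> V \<times> W)"
      by (intro image_eqI[of _ _ "(x, y, z)"]) (auto simp: map111_def)
  next
    fix q assume "q \<in> map111 ` (U \<times> V \<times> W)"
    then obtain x y z where xyz: "x \<in> U" "y \<in> V" "z \<in> W" "q = (x - y, y - z)"
      by (auto simp: map111_def)
    then have "q = (?f x + ?g y) + ?h z" by simp
    then show "q \<in> {x + y | x y. x \<in> ?UV \<and> y \<in> ?h ` W}" using xyz by blast
  qed
  ultimately show ?thesis by (simp only: UV dims)
qed

lemma linear_injection_into_subspace: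
  fixes W :: "('a::field ^ 'k) set"
  assumes "CARD('m::finite) \<le> vec.dim W" and W: "vec.subspace W"
  obtains f :: "'a ^ 'm \<Rightarrow> 'a ^ 'k"
  where "Vector_Spaces.linear (*s) (*s) f" "inj f" "range f \<subseteq> W"
proof -
  obtain B where B: "B \<subseteq> W" "vec.independent B" "card B = vec.dim W"
    using vec.basis_exists by metis
  have finB: "finite B" using B(2) by (rule vec.finiteI_independent)
  obtain h :: "'m \<Rightarrow> 'a ^ 'k" where h: "range h \<subseteq> B" "inj h"
    using card_le_inj[of "UNIV :: 'm set" B] assms(1) B(3) finB by auto
  define f where "f a = (\<Sum>l\<in>UNIV. a $ l *s h l)" for a
  have lin: "Vector_Spaces.linear (*s) (*s) f"
    by (rule vec_linearI)
      (simp_all add: f_def vec.scale_left_distrib sum.distrib vec.scale_sum_right)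
  have "a = 0" if "f a = 0" for a
  proof -
    have "(\<Sum>b\<in>range h. a $ inv h b *s b) = 0"
      using that h(2) by (simp add: f_def sum.reindex)
    then have "a $ inv h (h l) = 0" for l
      using vec.independentD[OF B(2) finite_subset[OF h(1) finB] h(1), of "\<lambda>b. a $ inv h b" "h l"]
      by simp
    then show ?thesis using h(2) by (simp add: vec_eq_iff)
  qed
  then have "inj f" by (simp add: vec.linear_inj_iff_eq_0[OF lin])
  moreover have "range f \<subseteq> W"
    using h(1) B(1) by (auto simp: f_def intro!: vec.subspace_sum[OF W] vec.subspace_scale[OF W])
  ultimately show thesis using lin that by blast
qed

text \<open>
  The map \<open>p \<mapsto> (r p, c p, d p)\<close> tells which tensor index is the row, which is the column of the
  matrices \<open>S \<alpha>\<close>, and which belongs to the remaining factor. Keeping it general covers the three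
  positions at once. The matrix \<open>X\<close> lists, for each index of the remaining factor, the argument
  of \<open>S\<close> used there; its entries are \<open>CARD('m) * CARD('l)\<close> free parameters when \<open>S\<close> is injective.
\<close>

lemma span_simple_tensors:
  fixes S :: "complex ^ ('m::finite) \<Rightarrow> complex ^ ('n::finite) ^ ('k::finite)" and r :: "'p::finite \<Rightarrow> 'k"
    and c :: "'p \<Rightarrow> 'n" and d :: "'p \<Rightarrow> 'l::finite"
  assumes lin: "Vector_Spaces.linear (*s) (*s) (\<lambda>\<alpha>. mat_vec (S \<alpha>))"
  shows "vec.span {\<chi> p. M $ r p $ c p * a $ d p | M a. M \<in> range S}
      = range (\<lambda>X :: complex ^ 'l ^ 'm. \<chi> p. S (column (d p) X) $ r p $ c p)"
    and "inj S \<Longrightarrow> surj (\<lambda>p. (r p, c p, d p))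
      \<Longrightarrow> vec.dim (vec.span {\<chi> p. M $ r p $ c p * a $ d p | M a. M \<in> range S})
        = CARD('m) * CARD('l)"
proof -
  let ?gen = "{\<chi> p. M $ r p $ c p * a $ d p | M a. M \<in> range S}"
  let ?act = "\<lambda>X :: complex ^ 'l ^ 'm. (\<chi> p. S (column (d p) X) $ r p $ c p) :: complex ^ 'p"
  let ?un = "\<lambda>x :: complex ^ ('m \<times> 'l). \<chi> i l. x $ (i, l)"
  have S_add: "S (x + y) $ k $ n = S x $ k $ n + S y $ k $ n" for x y k n
    using vec.linear_add[OF lin, of x y] by (simp add: mat_vec_def vec_eq_iff)
  have S_scale: "S (t *s x) $ k $ n = t * S x $ k $ n" for t x k n
    using vec.linear_scale[OF lin, of t x] by (simp add: mat_vec_def vec_eq_iff)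
  have col_add: "column l (?un (x + y)) = column l (?un x) + column l (?un y)"
    and col_scale: "column l (?un (t *s x)) = t *s column l (?un x)" for l x y t
    by (simp_all add: column_def vec_eq_iff)
  have lin_act: "Vector_Spaces.linear (*s) (*s) (\<lambda>x. ?act (?un x))"
    by (rule vec_linearI; simp only: col_add col_scale)
      (simp_all add: S_add S_scale vec_eq_iff)
  have range: "range ?act = range (\<lambda>x. ?act (?un x))"
  proof (intro equalityI subsetI)
    fix y assume "y \<in> range ?act"
    then obtain X where X: "y = ?act X" by blast
    have "?un (\<chi> p. X $ fst p $ snd p) = X" by (simp add: vec_eq_iff)
    then have "y = ?act (?un (\<chi> p. X $ fst p $ snd p))" unfolding X by (simp only:)
    then show "y \<in> range (\<lambda>x. ?act (?un x))" by (rule range_eqI)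
  qed blast
  show span: "vec.span ?gen = range ?act"
  proof (intro equalityI subsetI)
    fix y assume "y \<in> vec.span ?gen"
    moreover have "?gen \<subseteq> range ?act"
    proof
      fix y assume "y \<in> ?gen"
      then obtain \<alpha> a where y: "y = (\<chi> p. S \<alpha> $ r p $ c p * a $ d p)" by blast
      have "column l (\<chi> i l. \<alpha> $ i * a $ l) = a $ l *s \<alpha>" for l
        by (simp add: column_def vec_eq_iff)
      then have "y = ?act (\<chi> i l. \<alpha> $ i * a $ l)"
        unfolding y by (simp only: S_scale mult.commute)
      then show "y \<in> range ?act" by blast
    qed
    moreover have "vec.subspace (range ?act)"
      unfolding range by (rule vec.linear_subspace_image[OF lin_act vec.subspace_UNIV])
    ultimately show "y \<in> range ?act" using vec.span_minimal by blast
  next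
    fix y assume "y \<in> range ?act"
    then obtain X where X: "y = ?act X" by blast
    have "y = (\<Sum>l\<in>UNIV. \<chi> p. S (column l X) $ r p $ c p * axis l 1 $ d p)"
      by (simp add: X vec_eq_iff axis_def if_distrib[of "\<lambda>z. _ * z"] cong: if_cong)
    also have "\<dots> \<in> vec.span ?gen"
      by (intro vec.span_sum vec.span_base) blast
    finally show "y \<in> vec.span ?gen" .
  qed
  assume S: "inj S" and surj: "surj (\<lambda>p. (r p, c p, d p))"
  have "x = 0" if x: "?act (?un x) = 0" for x
  proof -
    have "S (column l (?un x)) $ k $ n = S 0 $ k $ n" for k n l
    proof -
      obtain p where "r p = k" "c p = n" "d p = l"
        using surjD[OF surj, of "(k, n, l)"] by auto
      then show ?thesis using x S_scale[of 0 0] by (auto simp: vec_eq_iff)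
    qed
    then have "S (column l (?un x)) = S 0" for l by (simp add: vec_eq_iff)
    then have "column l (?un x) = 0" for l using injD[OF S] by blast
    then show ?thesis by (simp add: column_def vec_eq_iff)
  qed
  then have "inj (\<lambda>x. ?act (?un x))" by (simp add: vec.linear_inj_iff_eq_0[OF lin_act])
  then show "vec.dim (vec.span ?gen) = CARD('m) * CARD('l)"
    unfolding span range
    by (subst vec.dim_image_eq[OF lin_act]) (auto simp: card_cart_basis intro: inj_on_subset)
qed

section \<open>Endomorphisms acting on a tensor\<close>

text \<open>
  The action of an endomorphism of \<open>A\<^sup>*\<close> (dually, of \<open>A\<close>) on the first factor, and likewise for \<open>B\<close>
  and \<open>C\<close>. The matrix is indexed so that it acts on the arguments of the slice map without a
  transposition.
\<close>

definition act\<^sub>A :: "complex ^ 'm ^ 'm \<Rightarrow> 'm::finite tensor \<Rightarrow> 'm tensor" where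
  "act\<^sub>A X T = (\<chi> p. case p of (i, j, k) \<Rightarrow> \<Sum>i'\<in>UNIV. X $ i' $ i * T $ (i', j, k))"

definition act\<^sub>B :: "complex ^ 'm ^ 'm \<Rightarrow> 'm::finite tensor \<Rightarrow> 'm tensor" where
  "act\<^sub>B Y T = (\<chi> p. case p of (i, j, k) \<Rightarrow> \<Sum>j'\<in>UNIV. Y $ j' $ j * T $ (i, j', k))"

definition act\<^sub>C :: "complex ^ 'm ^ 'm \<Rightarrow> 'm::finite tensor \<Rightarrow> 'm tensor" where
  "act\<^sub>C Z T = (\<chi> p. case p of (i, j, k) \<Rightarrow> \<Sum>k'\<in>UNIV. Z $ k' $ k * T $ (i, j, k'))"

lemmas slice_defs = T\<^sub>A_def T\<^sub>B_def T\<^sub>C_def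
lemmas act_defs = act\<^sub>A_def act\<^sub>B_def act\<^sub>C_def

lemma slice_action_same:
  shows T\<^sub>A_act\<^sub>A: "T\<^sub>A (act\<^sub>A X T) \<alpha> = T\<^sub>A T (X *v \<alpha>)"
    and T\<^sub>B_act\<^sub>B: "T\<^sub>B (act\<^sub>B X T) \<alpha> = T\<^sub>B T (X *v \<alpha>)"
    and T\<^sub>C_act\<^sub>C: "T\<^sub>C (act\<^sub>C X T) \<alpha> = T\<^sub>C T (X *v \<alpha>)"
  unfolding slice_defs act_defs matrix_vector_mult_def vec_eq_iff
  by (simp_all add: sum_distrib_left sum_distrib_right, (subst sum.swap, simp add: ac_simps)+)

lemma slice_action_columns:
  shows T\<^sub>A_act\<^sub>B: "T\<^sub>A (act\<^sub>B X T) \<alpha> = T\<^sub>A T \<alpha> ** X"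
    and T\<^sub>B_act\<^sub>A: "T\<^sub>B (act\<^sub>A X T) \<alpha> = T\<^sub>B T \<alpha> ** X"
    and T\<^sub>C_act\<^sub>A: "T\<^sub>C (act\<^sub>A X T) \<alpha> = T\<^sub>C T \<alpha> ** X"
  unfolding slice_defs act_defs matrix_matrix_mult_def vec_eq_iff
  by (simp_all add: sum_distrib_left sum_distrib_right, (subst sum.swap, simp add: ac_simps)+)

lemma slice_action_rows:
  shows T\<^sub>A_act\<^sub>C: "T\<^sub>A (act\<^sub>C X T) \<alpha> = transpose X ** T\<^sub>A T \<alpha>"
    and T\<^sub>B_act\<^sub>C: "T\<^sub>B (act\<^sub>C X T) \<alpha> = transpose X ** T\<^sub>B T \<alpha>"
    and T\<^sub>C_act\<^sub>B: "T\<^sub>C (act\<^sub>B X T) \<alpha> = transpose X ** T\<^sub>C T \<alpha>"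
  unfolding slice_defs act_defs matrix_matrix_mult_def transpose_def vec_eq_iff
  by (simp_all add: sum_distrib_left sum_distrib_right, (subst sum.swap, simp add: ac_simps)+)

lemma act_0: "act\<^sub>A 0 T = 0" "act\<^sub>B 0 T = 0" "act\<^sub>C 0 T = 0"
  by (simp_all add: act_defs vec_eq_iff)

lemma slice_linear:
  shows T\<^sub>A_linear: "Vector_Spaces.linear (*s) (*s) (\<lambda>\<alpha>. mat_vec (T\<^sub>A T \<alpha>))"
    and T\<^sub>B_linear: "Vector_Spaces.linear (*s) (*s) (\<lambda>\<alpha>. mat_vec (T\<^sub>B T \<alpha>))"
    and T\<^sub>C_linear: "Vector_Spaces.linear (*s) (*s) (\<lambda>\<alpha>. mat_vec (T\<^sub>C T \<alpha>))"
  by (rule vec_linearI; simp add: mat_vec_def slice_defs vec_eq_iff distrib_right sum.distrib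
      sum_distrib_left mult.assoc)+

lemma slice_linear_tensor:
  assumes f: "Vector_Spaces.linear (*s) (*s) f"
  shows T\<^sub>A_linear_tensor: "Vector_Spaces.linear (*s) (*s) (\<lambda>a. mat_vec (T\<^sub>A (f a) \<alpha>))"
    and T\<^sub>B_linear_tensor: "Vector_Spaces.linear (*s) (*s) (\<lambda>a. mat_vec (T\<^sub>B (f a) \<alpha>))"
    and T\<^sub>C_linear_tensor: "Vector_Spaces.linear (*s) (*s) (\<lambda>a. mat_vec (T\<^sub>C (f a) \<alpha>))"
  by (rule vec_linearI; simp add: vec.linear_add[OF f] vec.linear_scale[OF f] mat_vec_def slice_defs
      vec_eq_iff distrib_left sum.distrib sum_distrib_left mult.left_commute)+

lemma slice_vector_swap:
  shows T\<^sub>A_vector: "T\<^sub>A T \<alpha> *v \<beta> = T\<^sub>B T \<beta> *v \<alpha>"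
    and T\<^sub>C_vector: "T\<^sub>C T \<gamma> *v \<alpha> = \<gamma> v* T\<^sub>A T \<alpha>"
  unfolding slice_defs matrix_vector_mult_def vector_matrix_mult_def vec_eq_iff
  by (simp_all add: sum_distrib_left sum_distrib_right, (subst sum.swap, simp add: ac_simps)+)

lemma entry_eq_T\<^sub>A_axis: "R $ (i, j, k) = T\<^sub>A R (axis i 1) $ k $ j"
  by (simp add: T\<^sub>A_def axis_def if_distrib[of "\<lambda>z. z * _"] cong: if_cong)

lemma slice_0: "T\<^sub>A T 0 = 0" "T\<^sub>B T 0 = 0" "T\<^sub>C T 0 = 0"
  by (simp_all add: slice_defs vec_eq_iff)

text \<open>
  A common kernel vector of the slices in one direction is a vector at which the slice map in another
  direction vanishes.
\<close>

lemma slice_nondegenerate: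
  assumes "concise T"
  shows T\<^sub>A_nondegenerate: "(\<And>\<alpha>. T\<^sub>A T \<alpha> *v u = 0) \<Longrightarrow> u = 0"
    and T\<^sub>B_nondegenerate: "(\<And>\<beta>. T\<^sub>B T \<beta> *v u = 0) \<Longrightarrow> u = 0"
    and T\<^sub>C_nondegenerate: "(\<And>\<gamma>. T\<^sub>C T \<gamma> *v u = 0) \<Longrightarrow> u = 0"
proof -
  have inj: "T\<^sub>A T u = 0 \<Longrightarrow> u = 0" "T\<^sub>B T u = 0 \<Longrightarrow> u = 0"
    using assms slice_0[of T] by (metis concise_def injD)+
  show "u = 0" if "\<And>\<alpha>. T\<^sub>A T \<alpha> *v u = 0"
    using that by (intro inj(2) matrix_eq_0I) (simp add: T\<^sub>A_vector)
  show "u = 0" if "\<And>\<beta>. T\<^sub>B T \<beta> *v u = 0"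
    using that by (intro inj(1) matrix_eq_0I) (simp add: T\<^sub>A_vector)
  show "u = 0" if "\<And>\<gamma>. T\<^sub>C T \<gamma> *v u = 0"
    using that by (intro inj(1) matrix_eq_0I_left) (simp add: T\<^sub>C_vector)
qed

lemma tensor_slices_range:
  shows TA_tensor_A_eq: "TA_tensor_A T = range (\<lambda>X. act\<^sub>A X T)"
    and TB_tensor_B_eq: "TB_tensor_B T = range (\<lambda>X. act\<^sub>B X T)"
    and TC_tensor_C_eq: "TC_tensor_C T = range (\<lambda>X. act\<^sub>C X T)"
proof -
  have "TA_tensor_A T = vec.span {\<chi> p. M $ snd (snd p) $ fst (snd p) * a $ fst p | M a. M \<in> range (T\<^sub>A T)}"
    by (simp add: TA_tensor_A_def case_prod_beta)
  also have "\<dots> = range (\<lambda>X. act\<^sub>A X T)"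
    unfolding span_simple_tensors(1)[OF T\<^sub>A_linear]
    by (simp add: act_defs slice_defs column_def case_prod_beta)
  finally show "TA_tensor_A T = range (\<lambda>X. act\<^sub>A X T)" .
  have "TB_tensor_B T = vec.span {\<chi> p. M $ snd (snd p) $ fst p * a $ fst (snd p) | M a. M \<in> range (T\<^sub>B T)}"
    by (simp add: TB_tensor_B_def case_prod_beta)
  also have "\<dots> = range (\<lambda>X. act\<^sub>B X T)"
    unfolding span_simple_tensors(1)[OF T\<^sub>B_linear]
    by (simp add: act_defs slice_defs column_def case_prod_beta)
  finally show "TB_tensor_B T = range (\<lambda>X. act\<^sub>B X T)" .
  have "TC_tensor_C T = vec.span {\<chi> p. M $ fst (snd p) $ fst p * a $ snd (snd p) | M a. M \<in> range (T\<^sub>C T)}"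
    by (simp add: TC_tensor_C_def case_prod_beta)
  also have "\<dots> = range (\<lambda>X. act\<^sub>C X T)"
    unfolding span_simple_tensors(1)[OF T\<^sub>C_linear]
    by (simp add: act_defs slice_defs column_def case_prod_beta)
  finally show "TC_tensor_C T = range (\<lambda>X. act\<^sub>C X T)" .
qed

lemma dim_tensor_slices:
  fixes T :: "'m::finite tensor"
  assumes "concise T"
  shows "vec.dim (TA_tensor_A T) = CARD('m)\<^sup>2"
    and "vec.dim (TB_tensor_B T) = CARD('m)\<^sup>2"
    and "vec.dim (TC_tensor_C T) = CARD('m)\<^sup>2"
proof -
  have inj: "inj (T\<^sub>A T)" "inj (T\<^sub>B T)" "inj (T\<^sub>C T)"
    using assms by (auto simp: concise_def)
  have "surj (\<lambda>p :: 'm \<times> 'm \<times> 'm. (snd (snd p), fst (snd p), fst p))"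
    by (rule surjI[where f = "\<lambda>p. (snd (snd p), fst (snd p), fst p)"]) simp
  from span_simple_tensors(2)[OF T\<^sub>A_linear inj(1) this]
  show "vec.dim (TA_tensor_A T) = CARD('m)\<^sup>2"
    by (simp add: TA_tensor_A_def case_prod_beta power2_eq_square)
  have "surj (\<lambda>p :: 'm \<times> 'm \<times> 'm. (snd (snd p), fst p, fst (snd p)))"
    by (rule surjI[where f = "\<lambda>p. (fst (snd p), snd (snd p), fst p)"]) simp
  from span_simple_tensors(2)[OF T\<^sub>B_linear inj(2) this]
  show "vec.dim (TB_tensor_B T) = CARD('m)\<^sup>2"
    by (simp add: TB_tensor_B_def case_prod_beta power2_eq_square)
  have "surj (\<lambda>p :: 'm \<times> 'm \<times> 'm. (fst (snd p), fst p, snd (snd p)))"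
    by (rule surjI[where f = "\<lambda>p. (fst (snd p), fst p, snd (snd p))"]) simp
  from span_simple_tensors(2)[OF T\<^sub>C_linear inj(3) this]
  show "vec.dim (TC_tensor_C T) = CARD('m)\<^sup>2"
    by (simp add: TC_tensor_C_def case_prod_beta power2_eq_square)
qed

section \<open>The 111-equations and the triple intersection\<close>

abbreviation triple_intersection :: "'m::finite tensor \<Rightarrow> 'm tensor set" where
  "triple_intersection T \<equiv> TA_tensor_A T \<inter> TB_tensor_B T \<inter> TC_tensor_C T"

lemma subspace_tensor_slices:
  "vec.subspace (TA_tensor_A T)" "vec.subspace (TB_tensor_B T)" "vec.subspace (TC_tensor_C T)"
  unfolding TA_tensor_A_def TB_tensor_B_def TC_tensor_C_def by (rule vec.subspace_span)+

lemma equations111_iff_dim: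
  fixes T :: "'m::finite tensor"
  assumes "concise T"
  shows "equations111 T \<longleftrightarrow> CARD('m) \<le> vec.dim (triple_intersection T)"
proof -
  \<comment> \<open>so the natural-number subtraction in the bound \<open>3 m\<^sup>2 - m\<close> does not truncate\<close>
  have "CARD('m) \<le> CARD('m)\<^sup>2" by (simp add: power2_eq_square)
  moreover have "vec_prod.p.dim (map111 ` (TA_tensor_A T \<times> TB_tensor_B T \<times> TC_tensor_C T))
      + vec.dim (triple_intersection T) = 3 * CARD('m)\<^sup>2"
    using dim_map111_image[OF subspace_tensor_slices[of T]] by (simp add: dim_tensor_slices[OF assms])
  ultimately show ?thesis unfolding equations111_def by linarith
qed

text \<open>
  An \<open>m\<close>-dimensional subspace of the triple intersection is parametrised by \<open>f\<close>; each \<open>f a\<close> is the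
  effect on \<open>T\<close> of an endomorphism of each factor.
\<close>

lemma equations111_family:
  fixes T :: "'m::finite tensor"
  assumes concise: "concise T" and eqs: "equations111 T"
  obtains X Y Z where "family_111 (T\<^sub>A T) X (\<lambda>a. transpose (Z a)) Y"
    and "family_111 (T\<^sub>B T) Y (\<lambda>a. transpose (Z a)) X"
    and "family_111 (T\<^sub>C T) Z (\<lambda>a. transpose (Y a)) X"
proof -
  have "vec.subspace (triple_intersection T)"
    by (intro vec.subspace_inter subspace_tensor_slices)
  then obtain f :: "complex ^ 'm \<Rightarrow> 'm tensor" where
    f: "Vector_Spaces.linear (*s) (*s) f" "inj f" "range f \<subseteq> triple_intersection T"
    using eqs linear_injection_into_subspace unfolding equations111_iff_dim[OF concise] by blast
  have f_in: "f a \<in> TA_tensor_A T" "f a \<in> TB_tensor_B T" "f a \<in> TC_tensor_C T" for a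
    using f(3) by blast+
  have "\<forall>a. \<exists>X. f a = act\<^sub>A X T" using f_in(1) unfolding TA_tensor_A_eq by blast
  then obtain X where X: "\<forall>a. f a = act\<^sub>A (X a) T" by (rule choice[THEN exE])
  have "\<forall>a. \<exists>Y. f a = act\<^sub>B Y T" using f_in(2) unfolding TB_tensor_B_eq by blast
  then obtain Y where Y: "\<forall>a. f a = act\<^sub>B (Y a) T" by (rule choice[THEN exE])
  have "\<forall>a. \<exists>Z. f a = act\<^sub>C Z T" using f_in(3) unfolding TC_tensor_C_eq by blast
  then obtain Z where Z: "\<forall>a. f a = act\<^sub>C (Z a) T" by (rule choice[THEN exE])
  have f0: "a = 0" if "f a = 0" for a
    using that f(2) by (simp add: vec.linear_inj_iff_eq_0[OF f(1)])
  have eq_0: "X a = 0 \<Longrightarrow> a = 0" "Y a = 0 \<Longrightarrow> a = 0" "transpose (Y a) = 0 \<Longrightarrow> a = 0"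
    "transpose (Z a) = 0 \<Longrightarrow> a = 0" for a
  proof -
    show X0: "X a = 0 \<Longrightarrow> a = 0" using X f0 act_0(1) by metis
    show Y0: "Y a = 0 \<Longrightarrow> a = 0" using Y f0 act_0(2) by metis
    have Z0: "Z a = 0 \<Longrightarrow> a = 0" using Z f0 act_0(3) by metis
    show "transpose (Y a) = 0 \<Longrightarrow> a = 0" "transpose (Z a) = 0 \<Longrightarrow> a = 0"
      using Y0 Z0 by (simp_all add: transpose_def vec_eq_iff)
  qed
  have A: "T\<^sub>A T (X a *v \<alpha>) = T\<^sub>A (f a) \<alpha>" "T\<^sub>A T \<alpha> ** Y a = T\<^sub>A (f a) \<alpha>"
    "transpose (Z a) ** T\<^sub>A T \<alpha> = T\<^sub>A (f a) \<alpha>" for a \<alpha>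
    using T\<^sub>A_act\<^sub>A T\<^sub>A_act\<^sub>B T\<^sub>A_act\<^sub>C X Y Z by metis+
  have B: "T\<^sub>B T (Y a *v \<alpha>) = T\<^sub>B (f a) \<alpha>" "T\<^sub>B T \<alpha> ** X a = T\<^sub>B (f a) \<alpha>"
    "transpose (Z a) ** T\<^sub>B T \<alpha> = T\<^sub>B (f a) \<alpha>" for a \<alpha>
    using T\<^sub>B_act\<^sub>A T\<^sub>B_act\<^sub>B T\<^sub>B_act\<^sub>C X Y Z by metis+
  have C: "T\<^sub>C T (Z a *v \<alpha>) = T\<^sub>C (f a) \<alpha>" "T\<^sub>C T \<alpha> ** X a = T\<^sub>C (f a) \<alpha>"
    "transpose (Y a) ** T\<^sub>C T \<alpha> = T\<^sub>C (f a) \<alpha>" for a \<alpha>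
    using T\<^sub>C_act\<^sub>A T\<^sub>C_act\<^sub>B T\<^sub>C_act\<^sub>C X Y Z by metis+
  have inj: "inj (T\<^sub>A T)" "inj (T\<^sub>B T)" "inj (T\<^sub>C T)"
    using concise by (auto simp: concise_def)
  show thesis
  proof (rule that)
    show "family_111 (T\<^sub>A T) X (\<lambda>a. transpose (Z a)) Y"
      by (rule family_111.intro)
        (simp_all add: A inj T\<^sub>A_linear T\<^sub>A_linear_tensor[OF f(1)] T\<^sub>A_nondegenerate[OF concise] eq_0)
    show "family_111 (T\<^sub>B T) Y (\<lambda>a. transpose (Z a)) X"
      by (rule family_111.intro)
        (simp_all add: B inj T\<^sub>B_linear T\<^sub>B_linear_tensor[OF f(1)] T\<^sub>B_nondegenerate[OF concise] eq_0)
    show "family_111 (T\<^sub>C T) Z (\<lambda>a. transpose (Y a)) X"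
      by (rule family_111.intro)
        (simp_all add: C inj T\<^sub>C_linear T\<^sub>C_linear_tensor[OF f(1)] T\<^sub>C_nondegenerate[OF concise] eq_0)
  qed
qed

text \<open>
  The space of all \<open>T(\<alpha>) adj(K)\<close> with \<open>K = T(\<alpha>\<^sub>0)\<close> invertible is \<open>m\<close>-dimensional; its
  action on the factor \<open>C\<close> lands in the triple intersection.
\<close>

lemma one_A_generic_converse:
  fixes T :: "'m::finite tensor"
  assumes concise: "concise T" and generic: "one_A_generic T"
    and strassen: "strassen_equations (T\<^sub>A T)" and end_closed: "end_closed_equations (T\<^sub>A T)"
  shows "equations111 T"
proof -
  have inj: "inj (T\<^sub>A T)" "inj (T\<^sub>C T)" using concise by (auto simp: concise_def)
  obtain \<alpha>\<^sub>0 where rank: "rank (T\<^sub>A T \<alpha>\<^sub>0) = CARD('m)"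
    using generic by (auto simp: one_A_generic_def)
  define K where "K = T\<^sub>A T \<alpha>\<^sub>0"
  have d: "det K \<noteq> 0" using rank by (simp add: K_def det_nz_iff_full_rank)
  have "det (0 :: complex ^ 'm ^ 'm) = 0"
    by (rule det_zero_row(1)[of undefined]) (simp add: row_def vec_eq_iff)
  then have "\<alpha>\<^sub>0 \<noteq> 0" using d slice_0(1)[of T] by (auto simp: K_def)
  then have "vec.independent {\<alpha>\<^sub>0}" by simp
  then obtain B where B: "\<alpha>\<^sub>0 \<in> B" "vec.independent B" "vec.span B = UNIV"
    using vec.extend_basis_superset vec.independent_extend_basis vec.span_extend_basis
    by (metis insert_subset)
  have "finite (B - {\<alpha>\<^sub>0})" using B(2) by (simp add: vec.finiteI_independent)
  then obtain bs where bs: "set bs = B - {\<alpha>\<^sub>0}" "distinct bs" using finite_distinct_list by blast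
  have "insert \<alpha>\<^sub>0 (B - {\<alpha>\<^sub>0}) = B" using B(1) by blast
  then have basis: "is_basis (\<alpha>\<^sub>0 # bs)" using B bs by (simp add: is_basis_def)
  have closed: "T\<^sub>A T \<alpha>' ** adjugate K ** T\<^sub>A T \<alpha>'' \<in> range (T\<^sub>A T)" for \<alpha>' \<alpha>''
    using end_closed basis end_closed_iff_in_range[OF T\<^sub>A_linear inj(1) basis]
    unfolding end_closed_equations_def K_def by (metis list.sel(1))
  define f where "f a = act\<^sub>C (transpose (T\<^sub>A T a ** adjugate K)) T" for a
  have f_slice: "T\<^sub>A (f a) \<alpha> = T\<^sub>A T a ** adjugate K ** T\<^sub>A T \<alpha>" for a \<alpha>
    by (simp add: f_def T\<^sub>A_act\<^sub>C)
  have tensor_eq: "R = R'" if "\<And>\<alpha>. T\<^sub>A R \<alpha> = T\<^sub>A R' \<alpha>" for R R' :: "'m tensor"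
    using that by (simp add: vec_eq_iff entry_eq_T\<^sub>A_axis)
  have in_A: "f a \<in> TA_tensor_A T" for a
  proof -
    have "\<forall>\<alpha>. \<exists>\<gamma>. T\<^sub>A (f a) \<alpha> = T\<^sub>A T \<gamma>" using closed f_slice by (metis imageE)
    then obtain g where g: "\<forall>\<alpha>. T\<^sub>A (f a) \<alpha> = T\<^sub>A T (g \<alpha>)" by (rule choice[THEN exE])
    \<comment> \<open>the values of \<open>g\<close> at the unit vectors suffice to determine the endomorphism of \<open>A\<^sup>*\<close>\<close>
    define X where "X = (\<chi> i' i. g (axis i 1) $ i')"
    have "f a $ (i, j, k) = act\<^sub>A X T $ (i, j, k)" for i j k
    proof -
      have "f a $ (i, j, k) = T\<^sub>A T (g (axis i 1)) $ k $ j"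
        by (simp only: entry_eq_T\<^sub>A_axis g)
      also have "\<dots> = act\<^sub>A X T $ (i, j, k)" by (simp add: act\<^sub>A_def X_def T\<^sub>A_def)
      finally show ?thesis .
    qed
    then have "f a = act\<^sub>A X T" by (simp add: vec_eq_iff)
    then show ?thesis by (simp add: TA_tensor_A_eq)
  qed
  have in_B: "f a \<in> TB_tensor_B T" for a
  proof -
    have "f a = act\<^sub>B (adjugate K ** T\<^sub>A T a) T"
      using strassen by (intro tensor_eq)
        (simp add: f_slice T\<^sub>A_act\<^sub>B matrix_mul_assoc strassen_equations_def K_def)
    then show ?thesis by (simp add: TB_tensor_B_eq)
  qed
  have in_C: "f a \<in> TC_tensor_C T" for a by (simp add: f_def TC_tensor_C_eq)
  have lin: "Vector_Spaces.linear (*s) (*s) f"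
  proof (rule vec_linearI)
    show "f (x + y) = f x + f y" for x y
      by (simp add: f_def act\<^sub>C_def T\<^sub>A_def transpose_def matrix_matrix_mult_def vec_eq_iff
          distrib_right sum.distrib)
    show "f (c *s x) = c *s f x" for c x
      by (simp add: f_def act\<^sub>C_def T\<^sub>A_def transpose_def matrix_matrix_mult_def vec_eq_iff
          sum_distrib_left sum_distrib_right mult.assoc)
  qed
  have "a = 0" if "f a = 0" for a
  proof -
    have "T\<^sub>A T a ** mat (det K) = T\<^sub>A (f a) \<alpha>\<^sub>0"
      by (simp add: f_slice K_def adjugate_matrix_mul[symmetric] matrix_mul_assoc)
    also have "\<dots> = 0" using that by (simp add: T\<^sub>A_def vec_eq_iff)
    finally have "T\<^sub>A T a = T\<^sub>A T 0" using d by (simp add: matrix_mul_mat vec_eq_iff slice_0)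
    then show ?thesis using injD[OF inj(1)] by blast
  qed
  then have "inj f" by (simp add: vec.linear_inj_iff_eq_0[OF lin])
  then have "vec.dim (range f) = CARD('m)"
    by (subst vec.dim_image_eq[OF lin]) (auto simp: card_cart_basis intro: inj_on_subset)
  moreover have "range f \<subseteq> triple_intersection T" using in_A in_B in_C by blast
  ultimately show ?thesis
    unfolding equations111_iff_dim[OF concise] by (metis vec.dim_subset)
qed

theorem proposition1p2:
  fixes T :: "'m::finite tensor"
  assumes "concise T"
  shows "(equations111 T \<longrightarrow>
           (strassen_equations (T\<^sub>A T) \<and> strassen_equations (T\<^sub>B T) \<and> strassen_equations (T\<^sub>C T)) \<and>
           (end_closed_equations (T\<^sub>A T) \<and> end_closed_equations (T\<^sub>B T) \<and> end_closed_equations (T\<^sub>C T)))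
       \<and> (one_A_generic T \<longrightarrow>
           (equations111 T \<longleftrightarrow> strassen_equations (T\<^sub>A T) \<and> end_closed_equations (T\<^sub>A T)))"
proof -
  have "strassen_equations (T\<^sub>A T) \<and> strassen_equations (T\<^sub>B T) \<and> strassen_equations (T\<^sub>C T)
      \<and> end_closed_equations (T\<^sub>A T) \<and> end_closed_equations (T\<^sub>B T) \<and> end_closed_equations (T\<^sub>C T)"
    if "equations111 T"
    using equations111_family[OF assms that] family_111.equations_of_family by metis
  then show ?thesis using one_A_generic_converse[OF assms] by blast
qed

end
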